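(* Let $\alpha\in\mathbb{Z}_{\ge0}^m$ and $T\in\mathrm{PKD}(\alpha)$. Then every semi-proper, pinned labeling of $T$ of some shape $\alpha'$ with $\alpha'\preceq^{0}\alpha$ can be obtained from the proper labeling $\mathcal{L}_\alpha(T)$ by a finite sequence of exchange labelings.
   Context: A diagram is a finite set of cells $(c,r)\in\mathbb{Z}_{>0}^2$ (column $c$, row $r$, rows numbered upward). For $\alpha\in\mathbb{Z}_{\ge0}^m$, $\mathbb{D}(\alpha)=\{(c,i):1\le c\le\alpha_i\}$. A Kohnert move selects the rightmost cell of some row and moves it down within its column to the nearest vacant position below it (jumping over cells), if one exists; $\mathrm{KD}(\alpha)$ is the set of diagrams obtainable from $\mathbb{D}(\alpha)$ by finite sequences of Kohnert moves. A pinned left swap on a weak composition exchanges two parts $0<\alpha_r<\alpha_s$ with $r<s$; $\alpha'\preceq^{0}\alpha$ means $\alpha'$ is obtained from $\alpha$ by finitely many pinned left swaps. A labeling assigns a positive integer to each cell. It is semi-proper of shape $\alpha$ if (i) for each column $c$ the entries in column $c$ are distinct and form exactly $\{r:\alpha_r\ge c\}$; (ii) every entry in row $r$ is at least $r$; (iii) cells with a given entry weakly descend from left to right. It is pinned if each entry in column $1$ equals its row. For $T\in\mathrm{KD}(\alpha)$ the proper labeling $\mathcal{L}_\alpha(T)$ is built from right to left: once all columns right of $c$ are labeled, the labels $\{i:\alpha_i\ge c\}$ are assigned bijectively to the cells of column $c$ from bottom to top, each receiving the smallest unused label $i$ such that the cell labeled $i$ in column $c+1$, if it exists, lies weakly lower.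 $\mathrm{PKD}(\alpha)=\{T\in\mathrm{KD}(\alpha):\mathcal{L}_\alpha(T)\text{ pinned}\}$. For labels $r<s$ in a semi-proper labeling, $s$ touches $r$ at column $c$ if there is an $s$ in column $c+1$ lying weakly below the $r$ in column $c$; then $s$ crosses $r$ if there is an $r$ in column $c+1$ above that $s$, and otherwise $s$ abuts $r$. If $s$ abuts $r$ in column $c$ in a semi-proper labeling of shape $\alpha$, the exchange labeling $\mathcal{L}^{c}_{r,s}$ simultaneously changes every $r$ to $s$ and every $s$ to $r$ in columns $c+1,\ldots,d$, where $d$ is the leftmost column right of $c$ at which $s$ touches $r$ if it exists, and otherwise $d=\alpha_s$. *)

theory Defs
  imports "HOL-Library.FuncSet"
begin

text \<open>A cell is a pair (column, row); columns and rows are numbered from 1.\<close>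

type_synonym cell = "nat \<times> nat"
type_synonym diagram = "cell set"
type_synonym labeling = "cell \<Rightarrow> nat"

text \<open>A weak composition in \<open>\<int>\<^sub>\<ge>\<^sub>0\<^sup>m\<close> is a list of length \<open>m\<close>; \<open>part \<alpha> i\<close> is \<open>\<alpha>\<^sub>i\<close>, indexed from 1.\<close>

definition part :: "nat list \<Rightarrow> nat \<Rightarrow> nat" where
  "part \<alpha> i = (if 1 \<le> i \<and> i \<le> length \<alpha> then \<alpha> ! (i - 1) else 0)"

definition comp_diagram :: "nat list \<Rightarrow> diagram" where
  "comp_diagram \<alpha> = {(c, i). 1 \<le> i \<and> i \<le> length \<alpha> \<and> 1 \<le> c \<and> c \<le> part \<alpha> i}"

definition kohnert_move :: "diagram \<Rightarrow> diagram \<Rightarrow> bool" where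
  "kohnert_move D D' \<longleftrightarrow> (\<exists>c r r'.
     (c, r) \<in> D \<and> (\<forall>c'>c. (c', r) \<notin> D) \<and>
     1 \<le> r' \<and> r' < r \<and> (c, r') \<notin> D \<and> (\<forall>k. r' < k \<and> k < r \<longrightarrow> (c, k) \<in> D) \<and>
     D' = insert (c, r') (D - {(c, r)}))"

definition KD :: "nat list \<Rightarrow> diagram set" where
  "KD \<alpha> = {T. kohnert_move\<^sup>*\<^sup>* (comp_diagram \<alpha>) T}"

definition pinned_left_swap :: "nat list \<Rightarrow> nat list \<Rightarrow> bool" where
  "pinned_left_swap \<alpha> \<beta> \<longleftrightarrow> (\<exists>r s.
     1 \<le> r \<and> r < s \<and> s \<le> length \<alpha> \<and> 0 < part \<alpha> r \<and> part \<alpha> r < part \<alpha> s \<and>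
     \<beta> = \<alpha>[r - 1 := part \<alpha> s, s - 1 := part \<alpha> r])"

definition pinned_le :: "nat list \<Rightarrow> nat list \<Rightarrow> bool"  (infix "\<preceq>\<^sup>0" 50) where
  "\<alpha>' \<preceq>\<^sup>0 \<alpha> \<longleftrightarrow> pinned_left_swap\<^sup>*\<^sup>* \<alpha> \<alpha>'"

definition column :: "diagram \<Rightarrow> nat \<Rightarrow> diagram" where
  "column T c = {x \<in> T. fst x = c}"

definition column_labels :: "nat list \<Rightarrow> nat \<Rightarrow> nat set" where
  "column_labels \<alpha> c = {i. 1 \<le> i \<and> i \<le> length \<alpha> \<and> c \<le> part \<alpha> i}"

text \<open>A labeling of \<open>T\<close> is an extensional function on \<open>T\<close>, so that equality of labelings
  is equality on the cells of \<open>T\<close>.\<close>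

definition is_labeling :: "diagram \<Rightarrow> labeling \<Rightarrow> bool" where
  "is_labeling T L \<longleftrightarrow> L \<in> T \<rightarrow>\<^sub>E {1..}"

definition semi_proper :: "diagram \<Rightarrow> nat list \<Rightarrow> labeling \<Rightarrow> bool" where
  "semi_proper T \<alpha> L \<longleftrightarrow>
     is_labeling T L \<and>
     (\<forall>c\<ge>1. inj_on L (column T c) \<and> L ` column T c = column_labels \<alpha> c) \<and>
     (\<forall>c r. (c, r) \<in> T \<longrightarrow> r \<le> L (c, r)) \<and>
     (\<forall>c r c' r'. (c, r) \<in> T \<and> (c', r') \<in> T \<and> c < c' \<and> L (c, r) = L (c', r') \<longrightarrow> r' \<le> r)"

definition pinned :: "diagram \<Rightarrow> labeling \<Rightarrow> bool" where
  "pinned T L \<longleftrightarrow> (\<forall>r. (1, r) \<in> T \<longrightarrow> L (1, r) = r)"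

text \<open>The label of cell \<open>(c, r)\<close> in the proper labeling. The recursive calls refer only to cells
  that are labeled earlier: those below in column \<open>c\<close> (whose labels are already used) and those in
  column \<open>c + 1\<close>. The value is meaningful only when a suitable unused label exists, as it always
  does for \<open>T \<in> KD \<alpha>\<close>.\<close>

function proper_label :: "nat list \<Rightarrow> diagram \<Rightarrow> nat \<Rightarrow> nat \<Rightarrow> nat" where
  "proper_label \<alpha> T c r =
     (if finite T \<and> (c, r) \<in> T then
        (LEAST i. i \<in> column_labels \<alpha> c \<and>
           (\<forall>r'. r' < r \<and> (c, r') \<in> T \<longrightarrow> proper_label \<alpha> T c r' \<noteq> i) \<and>
           (\<forall>r'. (c + 1, r') \<in> T \<longrightarrow> proper_label \<alpha> T (c + 1) r' = i \<longrightarrow> r' \<le> r))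
      else undefined)"
  by pat_completeness auto
termination
proof (relation "measures [\<lambda>(\<alpha>, T, c, r). Max (fst ` T) + 1 - c, \<lambda>(\<alpha>, T, c, r). r]",
    goal_cases)
  case 1
  show ?case by simp
next
  case (2 \<alpha> T c r i r')
  then show ?case by simp
next
  case (3 \<alpha> T c r i r')
  then have "c \<le> Max (fst ` T)"
    by (intro Max_ge) (auto intro: rev_image_eqI)
  then show ?case by (simp add: Suc_diff_le)
qed

declare proper_label.simps [simp del]

definition proper_labeling :: "nat list \<Rightarrow> diagram \<Rightarrow> labeling" where
  "proper_labeling \<alpha> T = restrict (\<lambda>(c, r). proper_label \<alpha> T c r) T"

definition PKD :: "nat list \<Rightarrow> diagram set" where
  "PKD \<alpha> = {T \<in> KD \<alpha>. pinned T (proper_labeling \<alpha> T)}"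

definition touches :: "diagram \<Rightarrow> labeling \<Rightarrow> nat \<Rightarrow> nat \<Rightarrow> nat \<Rightarrow> bool" where
  "touches T L s r c \<longleftrightarrow> r < s \<and>
     (\<exists>x y. (c, x) \<in> T \<and> L (c, x) = r \<and> (c + 1, y) \<in> T \<and> L (c + 1, y) = s \<and> y \<le> x)"

definition crosses :: "diagram \<Rightarrow> labeling \<Rightarrow> nat \<Rightarrow> nat \<Rightarrow> nat \<Rightarrow> bool" where
  "crosses T L s r c \<longleftrightarrow> touches T L s r c \<and>
     (\<exists>y z. (c + 1, y) \<in> T \<and> L (c + 1, y) = s \<and> (c + 1, z) \<in> T \<and> L (c + 1, z) = r \<and> y < z)"

definition abuts :: "diagram \<Rightarrow> labeling \<Rightarrow> nat \<Rightarrow> nat \<Rightarrow> nat \<Rightarrow> bool" where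
  "abuts T L s r c \<longleftrightarrow> touches T L s r c \<and> \<not> crosses T L s r c"

definition exchange_end :: "diagram \<Rightarrow> nat list \<Rightarrow> labeling \<Rightarrow> nat \<Rightarrow> nat \<Rightarrow> nat \<Rightarrow> nat" where
  "exchange_end T \<alpha> L c r s =
     (if \<exists>d>c. touches T L s r d then (LEAST d. c < d \<and> touches T L s r d) else part \<alpha> s)"

definition exchange :: "diagram \<Rightarrow> nat list \<Rightarrow> labeling \<Rightarrow> nat \<Rightarrow> nat \<Rightarrow> nat \<Rightarrow> labeling" where
  "exchange T \<alpha> L c r s =
     restrict (\<lambda>(k, x).
       if c < k \<and> k \<le> exchange_end T \<alpha> L c r s
       then (if L (k, x) = r then s else if L (k, x) = s then r else L (k, x))
       else L (k, x)) T"

text \<open>The shape \<open>\<beta>\<close> is that of the current labeling \<open>L\<close>, which determines it up to trailing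
  zeros; it may change along a sequence of exchanges.\<close>

definition exchange_step :: "diagram \<Rightarrow> labeling \<Rightarrow> labeling \<Rightarrow> bool" where
  "exchange_step T L L' \<longleftrightarrow> (\<exists>\<beta> c r s.
     semi_proper T \<beta> L \<and> abuts T L s r c \<and> L' = exchange T \<beta> L c r s)"

end

theory Submission imports Defs begin

text \<open>Both halves of the argument undo an exchange. Let \<open>L\<close> be semi-proper and pinned, \<open>r < s\<close>, and
  suppose that in column \<open>d\<close> the \<open>r\<close> lies above the \<open>s\<close> while no \<open>r\<close> in column \<open>d + 1\<close> lies above
  that \<open>s\<close>, or that \<open>r\<close> ends in column \<open>d\<close> and \<open>s\<close> ends earlier. As \<open>r\<close> lies below \<open>s\<close> in column 1, there is a last column \<open>c < d\<close> such that the \<open>s\<close> in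
  column \<open>c\<close> lies weakly above the \<open>r\<close> in column \<open>c + 1\<close>; interchanging \<open>r\<close> and \<open>s\<close> in columns
  \<open>c + 1, \<dots>, d\<close> then gives a labeling of which \<open>L\<close> is the exchange at \<open>c\<close>.

  Undoing the pinned left swaps one at a time in this way leads from a labeling of shape \<open>\<alpha>'\<close> to one
  of shape \<open>\<alpha>\<close>. For shape \<open>\<alpha>\<close>, scan the cells from right to left and from bottom to top in each
  column. At the first cell where \<open>L\<close> differs from the proper labeling, greediness says that the
  proper label \<open>r\<close> is smaller than the label \<open>s\<close> in \<open>L\<close>, and that \<open>r\<close> lies above \<open>s\<close> in that column
  of \<open>L\<close>; undoing an exchange of \<open>r\<close> and \<open>s\<close> that ends in this column corrects the cell.\<close>

section \<open>Diagrams reached by Kohnert moves\<close>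

lemma KD_finite_columns:
  assumes "T \<in> KD \<alpha>"
  shows "finite T \<and> T \<subseteq> {1..} \<times> UNIV"
proof -
  have "kohnert_move\<^sup>*\<^sup>* (comp_diagram \<alpha>) T"
    using assms by (simp add: KD_def)
  then show ?thesis
  proof induction
    case base
    have "comp_diagram \<alpha> \<subseteq> (\<Union>i\<in>{1..length \<alpha>}. {1..part \<alpha> i} \<times> {i})"
      by (auto simp: comp_diagram_def)
    then have "finite (comp_diagram \<alpha>)"
      by (rule finite_subset) auto
    then show ?case by (auto simp: comp_diagram_def)
  next
    case (step D D')
    then show ?case by (auto simp: kohnert_move_def)
  qed
qed

section \<open>Semi-proper labelings, label by label\<close>

text \<open>The relational form turns a swap of labels into a substitution in the argument
  \<open>i\<close>, and lets "label \<open>i\<close> occurs in column \<open>c\<close>" be an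
  existential statement.\<close>

definition has_label :: "diagram \<Rightarrow> labeling \<Rightarrow> nat \<Rightarrow> nat \<Rightarrow> nat \<Rightarrow> bool" where
  "has_label T L c i x \<longleftrightarrow> (c, x) \<in> T \<and> L (c, x) = i"

lemma semi_proper_unique:
  assumes "semi_proper T \<alpha> L" "1 \<le> c" "has_label T L c i x" "has_label T L c i y"
  shows "x = y"
proof -
  have "inj_on L (column T c)" using assms(1,2) by (simp add: semi_proper_def)
  then have "(c, x) = (c, y)"
    by (rule inj_onD) (use assms(3,4) in \<open>auto simp: has_label_def column_def\<close>)
  then show ?thesis by simp
qed

lemma semi_proper_ex_iff:
  assumes "semi_proper T \<alpha> L" "1 \<le> c"
  shows "(\<exists>x. has_label T L c i x) \<longleftrightarrow> i \<in> column_labels \<alpha> c"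
proof -
  have "L ` column T c = column_labels \<alpha> c" using assms by (simp add: semi_proper_def)
  moreover have "(\<exists>x. has_label T L c i x) \<longleftrightarrow> i \<in> L ` column T c"
    by (force simp: has_label_def column_def)
  ultimately show ?thesis by simp
qed

lemma semi_proper_descends:
  assumes "semi_proper T \<alpha> L" "1 \<le> c" "c \<le> c'" "has_label T L c i x" "has_label T L c' i y"
  shows "y \<le> x"
proof (cases "c = c'")
  case True
  then show ?thesis using semi_proper_unique assms by blast
next
  case False
  then have "c < c'" using assms(3) by simp
  moreover have "\<forall>c r c' r'. (c, r) \<in> T \<and> (c', r') \<in> T \<and> c < c' \<and> L (c, r) = L (c', r') \<longrightarrow> r' \<le> r"
    using assms(1) unfolding semi_proper_def by (elim conjE)
  ultimately show ?thesis using assms(4,5) unfolding has_label_def by metis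
qed

text \<open>The bound of a row by its label comes for free: every label occurs in column 1, where
  pinning puts it in the row of its own number, and from there it only descends.\<close>

lemma semi_properI:
  assumes "is_labeling T L" "T \<subseteq> {1..} \<times> UNIV"
    and unique: "\<And>c i x y. 1 \<le> c \<Longrightarrow> has_label T L c i x \<Longrightarrow> has_label T L c i y \<Longrightarrow> x = y"
    and ex_iff: "\<And>c i. 1 \<le> c \<Longrightarrow> (\<exists>x. has_label T L c i x) \<longleftrightarrow> i \<in> column_labels \<alpha> c"
    and descends: "\<And>c c' i x y. 1 \<le> c \<Longrightarrow> c < c' \<Longrightarrow> has_label T L c i x \<Longrightarrow> has_label T L c' i y \<Longrightarrow> y \<le> x"
    and "pinned T L"
  shows "semi_proper T \<alpha> L"
proof -
  have "inj_on L (column T c)" if "1 \<le> c" for c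
    using unique[OF that] by (auto simp: inj_on_def column_def has_label_def)
  moreover have "L ` column T c = column_labels \<alpha> c" if "1 \<le> c" for c
    unfolding set_eq_iff ex_iff[OF that, symmetric]
    by (force simp: column_def has_label_def)
  moreover have "x \<le> L (c, x)" if "(c, x) \<in> T" for c x
  proof (cases "c = 1")
    case True
    then show ?thesis using assms(6) that by (simp add: pinned_def)
  next
    case False
    then have c: "1 < c" using assms(2) that by force
    have "has_label T L c (L (c, x)) x" using that by (simp add: has_label_def)
    moreover have "L (c, x) \<in> column_labels \<alpha> 1"
      using calculation ex_iff[of c "L (c, x)"] c by (auto simp: column_labels_def)
    then obtain y where y: "has_label T L 1 (L (c, x)) y" using ex_iff[of 1] by auto
    moreover have "y = L (c, x)" using y assms(6) by (auto simp: pinned_def has_label_def)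
    ultimately show ?thesis using descends[of 1 c] c by auto
  qed
  moreover have "r' \<le> r" if "(c, r) \<in> T \<and> (c', r') \<in> T \<and> c < c' \<and> L (c, r) = L (c', r')" for c r c' r'
  proof -
    have "1 \<le> c" using assms(2) that by auto
    then show ?thesis using descends[of c c' "L (c, r)"] that by (simp add: has_label_def)
  qed
  ultimately show ?thesis
    unfolding semi_proper_def using assms(1) by (intro conjI allI impI)
qed

section \<open>Swapping two labels in a block of columns, and undoing an exchange\<close>

text \<open>An exchange with its right end \<open>d\<close> left free, so that it can be inverted
  before that end is known.\<close>

definition swap_labels :: "diagram \<Rightarrow> labeling \<Rightarrow> nat \<Rightarrow> nat \<Rightarrow> nat \<Rightarrow> nat \<Rightarrow> labeling" where
  "swap_labels T L c d r s = restrict (\<lambda>(k, x).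
     if c < k \<and> k \<le> d
     then (if L (k, x) = r then s else if L (k, x) = s then r else L (k, x))
     else L (k, x)) T"

lemma exchange_eq_swap_labels:
  "exchange T \<alpha> L c r s = swap_labels T L c (exchange_end T \<alpha> L c r s) r s"
  by (simp add: exchange_def swap_labels_def)

lemma swap_labels_involution:
  assumes "is_labeling T L"
  shows "swap_labels T (swap_labels T L c d r s) c d r s = L"
proof
  fix p
  show "swap_labels T (swap_labels T L c d r s) c d r s p = L p"
    using assms by (cases p) (auto simp: swap_labels_def is_labeling_def PiE_def extensional_def)
qed

lemma has_label_swap_labels:
  assumes "r \<noteq> s"
  shows "has_label T (swap_labels T L c d r s) k i x \<longleftrightarrow>
    has_label T L k (if c < k \<and> k \<le> d then (if i = r then s else if i = s then r else i) else i) x"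
  using assms by (auto simp: has_label_def swap_labels_def)

lemma pinned_swap_labels: "1 \<le> c \<Longrightarrow> pinned T L \<Longrightarrow> pinned T (swap_labels T L c d r s)"
  by (auto simp: pinned_def swap_labels_def)

lemma touches_has_label:
  "touches T L s r c \<longleftrightarrow> r < s \<and> (\<exists>x y. has_label T L c r x \<and> has_label T L (c + 1) s y \<and> y \<le> x)"
  by (auto simp: touches_def has_label_def)

lemma pinned_has_label_row:
  assumes "semi_proper T \<alpha> L" "pinned T L" "i \<in> column_labels \<alpha> 1"
  shows "has_label T L 1 i i"
  using semi_proper_ex_iff[OF assms(1), of 1 i] assms(2,3) by (auto simp: pinned_def has_label_def)

text \<open>The first alternative for \<beta> keeps the shape and serves to correct a single cell;
  the second undoes a pinned left swap, and there \<open>above\<close> and \<open>right\<close> hold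
  vacuously because column \<open>d\<close> has no \<open>s\<close>. The descent of labels can fail
  only across the two ends of the swapped block: the choice of \<open>c\<close> secures the left
  end, \<open>above\<close> and \<open>right\<close> the right end.\<close>

lemma exchange_pullback:
  assumes cols: "T \<subseteq> {1..} \<times> UNIV"
    and L: "semi_proper T \<alpha> L" and pin: "pinned T L"
    and "r < s" and rs: "r \<in> column_labels \<alpha> d" "s \<in> column_labels \<alpha> 1" and "1 < d"
    and beta: "\<beta> = \<alpha> \<and> s \<in> column_labels \<alpha> d \<or>
       \<beta> = \<alpha>[r - 1 := part \<alpha> s, s - 1 := part \<alpha> r] \<and> part \<alpha> r = d \<and> part \<alpha> s < d"
    and above: "\<And>x y. has_label T L d s x \<Longrightarrow> has_label T L d r y \<Longrightarrow> x < y"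
    and right: "\<And>x y. has_label T L d s x \<Longrightarrow> has_label T L (d + 1) r y \<Longrightarrow> y \<le> x"
  obtains c where "1 \<le> c" "c < d" "semi_proper T \<beta> (swap_labels T L c d r s)"
    "pinned T (swap_labels T L c d r s)" "exchange_step T (swap_labels T L c d r s) L"
proof -
  note ex = semi_proper_ex_iff[OF L] and desc = semi_proper_descends[OF L]
    and uniq = semi_proper_unique[OF L]
  have rk: "r \<in> column_labels \<alpha> k" if "k \<le> d" for k
    using rs that by (auto simp: column_labels_def)
  \<comment> \<open>For \<open>c < k\<close>, this says that \<open>s\<close> touches
    \<open>r\<close> at column \<open>k\<close> once both labels are swapped in columns
    \<open>c + 1\<close> to \<open>d\<close>. The last such \<open>k\<close> thus leaves no touch
    strictly inside the block.\<close>
  define Q where "Q k \<longleftrightarrow> k < d \<and> (\<exists>x y. has_label T L k s x \<and> has_label T L (k + 1) r y \<and> y \<le> x)" for k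
  have "Q 1"
  proof -
    have r1: "has_label T L 1 r r" and s1: "has_label T L 1 s s"
      using pinned_has_label_row[OF L pin] rk \<open>1 < d\<close> rs by auto
    obtain y where "has_label T L (1 + 1) r y" using ex[of "1 + 1" r] rk[of "1 + 1"] \<open>1 < d\<close> by auto
    then show ?thesis using r1 s1 desc[of 1 "1 + 1" r r y] \<open>r < s\<close> \<open>1 < d\<close>
      unfolding Q_def by force
  qed
  define c where "c = (GREATEST k. Q k)"
  have bound: "\<And>k. Q k \<Longrightarrow> k \<le> d" by (simp add: Q_def)
  have "Q c" unfolding c_def by (rule GreatestI_nat[where b=d and P=Q, OF \<open>Q 1\<close> bound])
  have "1 \<le> c" unfolding c_def by (rule Greatest_le_nat[where b=d and P=Q, OF \<open>Q 1\<close> bound])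
  have last: "\<not> Q k" if "c < k" for k
    using Greatest_le_nat[where b=d and P=Q and k=k, OF _ bound] that unfolding c_def by fastforce
  obtain sc rc where c: "c < d" "has_label T L c s sc" "has_label T L (c + 1) r rc" "rc \<le> sc"
    using \<open>Q c\<close> unfolding Q_def by blast
  obtain r0 where r0: "has_label T L c r r0" using ex[of c r] rk[of c] \<open>1 \<le> c\<close> c by auto
  obtain rd where rd: "has_label T L d r rd" using ex[of d r] rs \<open>1 < d\<close> by auto
  have sc_labels: "s \<in> column_labels \<alpha> c" using ex[of c s] c \<open>1 \<le> c\<close> by auto
  \<comment> \<open>In column \<open>c + 1\<close> the \<open>s\<close> lies strictly below the
    \<open>r\<close>: otherwise \<open>above\<close> fails, or \<open>Q (c + 1)\<close> holds
    because \<open>r\<close> descends into column \<open>c + 2\<close>.\<close>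
  have first: "x < rc" if "has_label T L (c + 1) s x" for x
  proof (cases "c + 1 = d")
    case True
    then show ?thesis using above that c by auto
  next
    case False
    then have lt: "c + 1 < d" using c by simp
    then obtain y where y: "has_label T L (c + 1 + 1) r y"
      using ex[of "c + 1 + 1" r] rk[of "c + 1 + 1"] by auto
    have "x < y" using last[of "c + 1"] lt that y unfolding Q_def by force
    also have "y \<le> rc" using desc[of "c + 1" "c + 1 + 1" r rc y] c y by simp
    finally show ?thesis .
  qed
  let ?M = "swap_labels T L c d r s"
  note M = has_label_swap_labels[of r s T L c d]
  have rs': "r \<noteq> s" "s \<noteq> r" using \<open>r < s\<close> by auto
  have len: "1 \<le> r" "r \<le> length \<alpha>" "1 \<le> s" "s \<le> length \<alpha>" using rs by (auto simp: column_labels_def)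
  have sd: "s \<in> column_labels \<alpha> d \<and> \<beta> = \<alpha>"
    if "d < k" "r \<in> column_labels \<alpha> k \<or> s \<in> column_labels \<alpha> k" for k
    using beta that by (auto simp: column_labels_def)
  have labels: "i \<in> column_labels \<beta> k \<longleftrightarrow>
    (if c < k \<and> k \<le> d then (if i = r then s else if i = s then r else i) else i) \<in> column_labels \<alpha> k" for i k
    using beta
  proof
    assume "\<beta> = \<alpha> \<and> s \<in> column_labels \<alpha> d"
    then show ?thesis using rs by (auto simp: column_labels_def)
  next
    assume b: "\<beta> = \<alpha>[r - 1 := part \<alpha> s, s - 1 := part \<alpha> r] \<and> part \<alpha> r = d \<and> part \<alpha> s < d"
    then have "part \<beta> i = (if i = r then part \<alpha> s else if i = s then part \<alpha> r else part \<alpha> i)"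
      using len rs' unfolding part_def by (auto simp: nth_list_update)
    \<comment> \<open>The \<open>s\<close> reaches column \<open>c\<close> by
      \<open>sc_labels\<close>, so trading tails after column \<open>c\<close> trades exactly the
      two part sizes.\<close>
    then show ?thesis using b len rs' sc_labels by (auto simp: column_labels_def)
  qed
  have pinM: "pinned T ?M" using pinned_swap_labels[OF \<open>1 \<le> c\<close> pin] .
  have semiM: "semi_proper T \<beta> ?M"
  proof (rule semi_properI[OF _ cols])
    show "is_labeling T ?M"
      using L len by (auto simp: semi_proper_def is_labeling_def swap_labels_def PiE_def Pi_def)
    show "pinned T ?M" by (rule pinM)
    show "x = y" if "1 \<le> k" "has_label T ?M k i x" "has_label T ?M k i y" for k i x y
      using that uniq M rs' by metis
    show "(\<exists>x. has_label T ?M k i x) \<longleftrightarrow> i \<in> column_labels \<beta> k" if "1 \<le> k" for k i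
      unfolding M[OF rs'(1)] labels by (rule ex[OF that])
    show "y \<le> x" if k: "1 \<le> k" "k < k'" and ix: "has_label T ?M k i x" and iy: "has_label T ?M k' i y"
      for k k' i x y
    proof -
      \<comment> \<open>One cell lies inside the block and the other outside, so their labels in
        \<open>L\<close> are different. The four cases compare them through
        \<open>rc \<le> sc\<close>, \<open>first\<close>, \<open>right\<close> and
        \<open>above\<close> respectively.\<close>
      have main: "y \<le> x" if x: "has_label T L k j x" and y: "has_label T L k' j' y"
        and jj: "j = s \<and> j' = r \<or> j = r \<and> j' = s" and k: "k \<le> c \<and> c < k' \<and> k' \<le> d \<or> c < k \<and> k \<le> d \<and> d < k'" for j j'
      proof -
        consider "k \<le> c" "c < k'" "k' \<le> d" "j = s" "j' = r" | "k \<le> c" "c < k'" "k' \<le> d" "j = r" "j' = s"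
          | "c < k" "k \<le> d" "d < k'" "j = s" "j' = r" | "c < k" "k \<le> d" "d < k'" "j = r" "j' = s"
          using jj k by blast
        then show ?thesis
        proof cases
          case 1
          have "y \<le> rc" using desc[of "c + 1" k' r rc y] 1 c y by simp
          also have "sc \<le> x" using desc[of k c s x sc] 1 \<open>1 \<le> k\<close> c x by simp
          then have "rc \<le> x" using c by simp
          finally show ?thesis .
        next
          case 2
          have "s \<in> column_labels \<alpha> (c + 1)" using ex[of k' s] y 2 by (auto simp: column_labels_def)
          then obtain z where z: "has_label T L (c + 1) s z" using ex[of "c + 1" s] by auto
          have "y \<le> z" using desc[of "c + 1" k' s z y] 2 z y by simp
          also have "z < rc" by (rule first[OF z])
          also have "rc \<le> x" using desc[of k "c + 1" r x rc] 2 \<open>1 \<le> k\<close> c x by simp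
          finally show ?thesis by simp
        next
          case 3
          have "r \<in> column_labels \<alpha> k'" using ex[of k' r] y 3 by auto
          moreover from this have "r \<in> column_labels \<alpha> (d + 1)" using 3 by (auto simp: column_labels_def)
          ultimately obtain z w where z: "has_label T L (d + 1) r z" "has_label T L d s w"
            using ex[of "d + 1" r] ex[of d s] sd[of k'] 3 \<open>1 < d\<close> by auto
          have "y \<le> z" using desc[of "d + 1" k' r z y] 3 z y by simp
          also have "z \<le> w" using right z by simp
          also have "w \<le> x" using desc[of k d s x w] 3 \<open>1 \<le> k\<close> z x by simp
          finally show ?thesis .
        next
          case 4
          have "s \<in> column_labels \<alpha> k'" using ex[of k' s] y 4 by auto
          then obtain w where w: "has_label T L d s w"
            using ex[of d s] sd[of k'] 4 \<open>1 < d\<close> by auto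
          have "y \<le> w" using desc[of d k' s w y] 4 w y \<open>1 < d\<close> by simp
          also have "w < rd" using above w rd by simp
          also have "rd \<le> x" using desc[of k d r x rd] 4 \<open>1 \<le> k\<close> rd x by simp
          finally show ?thesis by simp
        qed
      qed
      show ?thesis
      proof (cases "i \<in> {r, s} \<and> (k \<le> c \<and> c < k' \<and> k' \<le> d \<or> c < k \<and> k \<le> d \<and> d < k')")
        case True
        then have "\<exists>j j'. has_label T L k j x \<and> has_label T L k' j' y \<and> (j = s \<and> j' = r \<or> j = r \<and> j' = s)"
          using ix iy rs' unfolding M[OF rs'(1)] by auto
        then show ?thesis using main True by blast
      next
        case False
        then have "\<exists>j. has_label T L k j x \<and> has_label T L k' j y"
          using ix iy rs' k unfolding M[OF rs'(1)] by (auto split: if_splits)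
        then show ?thesis using desc k by (meson less_imp_le)
      qed
    qed
  qed
  have no_touch: "\<not> touches T ?M s r k" if "c < k" "k < d" for k
    using last[of k] that rs' unfolding touches_has_label Q_def M[OF rs'(1)] by auto
  \<comment> \<open>If \<open>s\<close> continues to column \<open>d + 1\<close>, its descent in
    \<open>L\<close> from column \<open>d\<close> is a touch in \<open>?M\<close>, since the
    \<open>s\<close> of \<open>L\<close> in column \<open>d\<close> is the \<open>r\<close> of
    \<open>?M\<close>. Otherwise the \<open>s\<close> of \<open>?M\<close> ends in column
    \<open>d\<close>, and the default \<open>part \<beta> s\<close> equals \<open>d\<close>.\<close>
  have "exchange_end T \<beta> ?M c r s = d"
  proof (cases "s \<in> column_labels \<alpha> (d + 1)")
    case True
    then have "s \<in> column_labels \<alpha> d" using sd by auto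
    then obtain x y where "has_label T L d s x" "has_label T L (d + 1) s y"
      using True ex[of d s] ex[of "d + 1" s] \<open>1 < d\<close> by auto
    moreover from this have "y \<le> x" using desc[of d "d + 1"] \<open>1 < d\<close> by simp
    ultimately have touch: "touches T ?M s r d"
      using \<open>r < s\<close> rs' c unfolding touches_has_label M[OF rs'(1)] by auto
    have "(LEAST k. c < k \<and> touches T ?M s r k) = d"
      by (rule Least_equality) (use touch no_touch c in \<open>auto simp: not_less[symmetric]\<close>)
    then show ?thesis using touch c unfolding exchange_end_def by auto
  next
    case False
    have "\<not> touches T ?M s r k" if k: "d \<le> k" for k
    proof
      assume "touches T ?M s r k"
      then obtain y where "has_label T L (k + 1) s y"
        using k c unfolding touches_has_label M[OF rs'(1)] by auto
      then have "s \<in> column_labels \<alpha> (k + 1)" using ex[of "k + 1" s] by auto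
      then show False using False k by (auto simp: column_labels_def)
    qed
    then have "\<not> (\<exists>k>c. touches T ?M s r k)" using no_touch by (meson not_le)
    moreover have "d \<le> part \<beta> s"
      using labels[of s d] rs c \<open>r < s\<close> by (auto simp: column_labels_def)
    moreover have "part \<beta> s < d + 1"
      using labels[of s "d + 1"] labels[of s d] rs c False by (auto simp: column_labels_def)
    ultimately show ?thesis unfolding exchange_end_def by auto
  qed
  then have "L = exchange T \<beta> ?M c r s"
    using swap_labels_involution[of T L c d r s] L
    by (simp add: exchange_eq_swap_labels semi_proper_def)
  moreover have "abuts T ?M s r c"
  proof -
    have "rc \<le> r0" using desc[of c "c + 1" r r0 rc] \<open>1 \<le> c\<close> r0 c by simp
    then have "touches T ?M s r c"
      using \<open>r < s\<close> r0 c unfolding touches_has_label M[OF rs'(1)] by auto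
    moreover have False if "has_label T ?M (c + 1) s y" "has_label T ?M (c + 1) r z" "y < z" for y z
    proof -
      have "has_label T L (c + 1) r y" "has_label T L (c + 1) s z"
        using that c rs' unfolding M[OF rs'(1)] by auto
      then show False using first[of z] uniq[of "c + 1" r y rc] c that by simp
    qed
    then have "\<not> crosses T ?M s r c" unfolding crosses_def has_label_def by blast
    ultimately show ?thesis by (simp add: abuts_def)
  qed
  ultimately have "exchange_step T ?M L" using semiM unfolding exchange_step_def by blast
  then show ?thesis using that \<open>1 \<le> c\<close> c semiM pinM by blast
qed

section \<open>Undoing a pinned left swap\<close>

lemma pinned_left_swap_pullback:
  assumes cols: "T \<subseteq> {1..} \<times> UNIV"
    and "pinned_left_swap \<beta> \<alpha>" "semi_proper T \<alpha> L" "pinned T L"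
  obtains L' where "semi_proper T \<beta> L'" "pinned T L'" "exchange_step T L' L"
proof -
  obtain r s where rs: "1 \<le> r" "r < s" "s \<le> length \<beta>" "0 < part \<beta> r" "part \<beta> r < part \<beta> s"
    and \<alpha>: "\<alpha> = \<beta>[r - 1 := part \<beta> s, s - 1 := part \<beta> r]"
    using assms(2) unfolding pinned_left_swap_def by blast
  have parts: "part \<alpha> r = part \<beta> s" "part \<alpha> s = part \<beta> r"
    using rs unfolding \<alpha> by (auto simp: part_def nth_list_update)
  have "\<beta> = \<alpha>[r - 1 := part \<alpha> s, s - 1 := part \<alpha> r]"
    unfolding parts unfolding \<alpha> using rs
    by (intro nth_equalityI) (auto simp: nth_list_update part_def)
  moreover have "r \<in> column_labels \<alpha> (part \<alpha> r)" "s \<in> column_labels \<alpha> 1"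
    using rs parts \<alpha> by (auto simp: column_labels_def)
  \<comment> \<open>The block is made to end at \<open>d = part \<alpha> r\<close>, the last column
    of \<open>r\<close>, which the shorter \<open>s\<close> does not reach.\<close>
  moreover have "\<not> has_label T L (part \<alpha> r) s x" for x
    using semi_proper_ex_iff[OF assms(3), of "part \<alpha> r" s] rs parts by (auto simp: column_labels_def)
  ultimately show ?thesis
    using exchange_pullback[OF cols assms(3,4) \<open>r < s\<close>, where d="part \<alpha> r" and \<beta>=\<beta>] rs parts that by auto
qed

section \<open>Labelings of the same shape as the proper labeling\<close>

lemma proper_labeling_reaches_same_shape:
  assumes "finite T" and cols: "T \<subseteq> {1..} \<times> UNIV"
    and P: "pinned T (proper_labeling \<alpha> T)"
    and "semi_proper T \<alpha> L" "pinned T L"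
  shows "(exchange_step T)\<^sup>*\<^sup>* (proper_labeling \<alpha> T) L"
proof -
  let ?P = "proper_labeling \<alpha> T"
  obtain N where N: "\<And>c x. (c, x) \<in> T \<Longrightarrow> x \<le> N"
  proof
    show "x \<le> Max (snd ` T)" if "(c, x) \<in> T" for c x
      using assms(1) that by (intro Max_ge) (auto intro: rev_image_eqI)
  qed
  \<comment> \<open>Keys decrease along the scan: as \<open>N\<close> bounds the rows, a column
    further right always has larger keys, and within a column lower cells do.\<close>
  define key where "key k x = k * (N + 1) + (N - x)" for k x
  have key_less: "key k x < key k' x'" if "k < k'" for k x k' x'
  proof -
    have "key k x < (k + 1) * (N + 1)" by (simp add: key_def)
    also have "\<dots> \<le> k' * (N + 1)" using that by (intro mult_le_mono1) simp
    also have "\<dots> \<le> key k' x'" by (simp add: key_def)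
    finally show ?thesis .
  qed
  have key_less_same: "key k x < key k x'" if "x' < x" "x \<le> N" for k x x'
    using that by (simp add: key_def)
  have key_Suc: "c < k \<or> c = k \<and> y < x"
    if "key c x < key k y" "(c, x) \<in> T" "(k, y) \<in> T" for c x k y
    using that key_less[of k c y x] key_less_same[of x y c] N[of k y]
    by (metis less_asym linorder_neqE_nat)
  \<comment> \<open>At \<open>n = 0\<close> the labelings coincide; passing from
    \<open>Suc n\<close> to \<open>n\<close> corrects the cell with key \<open>n\<close>, if it is
    wrong.\<close>
  have step: "(exchange_step T)\<^sup>*\<^sup>* ?P L" if "semi_proper T \<alpha> L" "pinned T L"
    "\<And>k y. (k, y) \<in> T \<Longrightarrow> n \<le> key k y \<Longrightarrow> L (k, y) = ?P (k, y)" for n L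
    using that
  proof (induction n arbitrary: L)
    case 0
    have "L = ?P"
    proof
      fix p
      show "L p = ?P p"
        using 0 by (cases "p \<in> T"; cases p)
          (auto simp: semi_proper_def is_labeling_def proper_labeling_def PiE_def extensional_def)
    qed
    then show ?case by simp
  next
    case (Suc n)
    show ?case
    proof (cases "\<exists>c x. (c, x) \<in> T \<and> key c x = n \<and> L (c, x) \<noteq> ?P (c, x)")
      case False
      then show ?thesis using Suc.IH[OF Suc.prems(1,2)] Suc.prems(3) by (metis Suc_leI le_neq_implies_less)
    next
      case True
      then obtain c x where cx: "(c, x) \<in> T" "key c x = n" "L (c, x) \<noteq> ?P (c, x)" by blast
      define r where "r = ?P (c, x)"
      define s where "s = L (c, x)"
      have agree: "L (k, y) = ?P (k, y)" if "(k, y) \<in> T" "c < k \<or> k = c \<and> y < x" for k y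
      proof -
        have "n < key k y" using that cx key_less[of c k x y] key_less_same[of y x c] N[of c x] by auto
        then show ?thesis using Suc.prems(3) that by simp
      qed
      note ex = semi_proper_ex_iff[OF Suc.prems(1)]
        and uniq = semi_proper_unique[OF Suc.prems(1)]
        and desc = semi_proper_descends[OF Suc.prems(1)]
      have "1 \<le> c" using cols cx by auto
      \<comment> \<open>Both labelings are pinned, so they agree in column 1.\<close>
      moreover have "c \<noteq> 1" using cx P Suc.prems(2) by (auto simp: pinned_def)
      ultimately have "1 < c" by simp
      \<comment> \<open>The greedy condition for the cell \<open>(c, x)\<close>, read off from
        \<open>L\<close>; it inspects only cells scanned earlier, where \<open>L\<close> and the
        proper labeling agree.\<close>
      define A where "A i \<longleftrightarrow> i \<in> column_labels \<alpha> c \<and>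
        (\<forall>y. y < x \<and> (c, y) \<in> T \<longrightarrow> L (c, y) \<noteq> i) \<and>
        (\<forall>y. (c + 1, y) \<in> T \<longrightarrow> L (c + 1, y) = i \<longrightarrow> y \<le> x)" for i
      have "A = (\<lambda>i. i \<in> column_labels \<alpha> c \<and>
        (\<forall>y. y < x \<and> (c, y) \<in> T \<longrightarrow> proper_label \<alpha> T c y \<noteq> i) \<and>
        (\<forall>y. (c + 1, y) \<in> T \<longrightarrow> proper_label \<alpha> T (c + 1) y = i \<longrightarrow> y \<le> x))"
        unfolding A_def using agree by (intro ext) (auto simp: proper_labeling_def)
      then have r_least: "r = (LEAST i. A i)"
        unfolding r_def proper_labeling_def using cx(1) \<open>finite T\<close>
        by (simp add: proper_label.simps[of \<alpha> T c x])
      have sx: "has_label T L c s x" using cx by (simp add: has_label_def s_def)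
      have "A s"
        unfolding A_def
      proof (intro conjI allI impI)
        show "s \<in> column_labels \<alpha> c" using ex[of c s] sx \<open>1 < c\<close> by auto
        show "L (c, y) \<noteq> s" if "y < x \<and> (c, y) \<in> T" for y
          using uniq[of c s x y] sx that \<open>1 < c\<close> by (auto simp: has_label_def)
        show "y \<le> x" if "(c + 1, y) \<in> T" "L (c + 1, y) = s" for y
          using desc[of c "c + 1" s x y] sx that \<open>1 < c\<close> by (auto simp: has_label_def)
      qed
      then have "A r" "r \<le> s" unfolding r_least by (auto intro: LeastI Least_le)
      moreover have "r \<noteq> s" using cx by (simp add: r_def s_def)
      ultimately have "r < s" by simp
      have rc: "r \<in> column_labels \<alpha> c" and sc: "s \<in> column_labels \<alpha> c"
        using \<open>A r\<close> \<open>A s\<close> by (auto simp: A_def)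
      have s1: "s \<in> column_labels \<alpha> 1" using sc \<open>1 < c\<close> by (auto simp: column_labels_def)
      have r_above: "x < y" if "has_label T L c r y" for y
        using \<open>A r\<close> that sx \<open>r \<noteq> s\<close> unfolding A_def has_label_def by (metis linorder_neqE_nat)
      obtain k where k: "1 \<le> k" "k < c" "semi_proper T \<alpha> (swap_labels T L k c r s)"
        "pinned T (swap_labels T L k c r s)" "exchange_step T (swap_labels T L k c r s) L"
      proof (rule exchange_pullback[OF cols Suc.prems(1,2) \<open>r < s\<close> rc s1 \<open>1 < c\<close>, where \<beta>=\<alpha>])
        show "y < z" if "has_label T L c s y" "has_label T L c r z" for y z
          using uniq[of c s x y] sx that r_above \<open>1 < c\<close> by auto
        show "z \<le> y" if "has_label T L c s y" "has_label T L (c + 1) r z" for y z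
          using uniq[of c s x y] sx that \<open>A r\<close> \<open>1 < c\<close> unfolding A_def has_label_def by auto
      qed (use sc in auto)
      \<comment> \<open>The swap spares the cells already correct: columns right of \<open>c\<close>
        lie outside the block, and the cells below \<open>x\<close> in column \<open>c\<close> carry
        neither \<open>r\<close> nor \<open>s\<close>.\<close>
      have agree': "swap_labels T L k c r s (j, y) = ?P (j, y)" if "(j, y) \<in> T" "n \<le> key j y" for j y
      proof (cases "(j, y) = (c, x)")
        case True
        then show ?thesis using k cx by (auto simp: swap_labels_def r_def s_def)
      next
        case False
        have "c < j \<or> c = j \<and> y < x"
        proof (cases "n = key j y")
          case True
          then have "j = c"
            using key_less[of j c y x] key_less[of c j x y] cx by (metis less_irrefl linorder_neqE_nat)
          then have "y = x"
            using True cx key_less_same[of x y c] key_less_same[of y x c] N[of c x] N[of j y] that(1)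
            by (metis less_irrefl linorder_neqE_nat)
          then show ?thesis using False \<open>j = c\<close> by simp
        next
          case neq: False
          then have "key c x < key j y" using that(2) cx(2) by simp
          then show ?thesis by (rule key_Suc[OF _ cx(1) that(1)])
        qed
        then show ?thesis
        proof
          assume "c < j"
          then show ?thesis using that agree[of j y] by (simp add: swap_labels_def)
        next
          assume j: "c = j \<and> y < x"
          then have "L (j, y) \<noteq> r" "L (j, y) \<noteq> s"
            using \<open>A r\<close> \<open>A s\<close> that unfolding A_def by auto
          then show ?thesis using that agree[of j y] j by (simp add: swap_labels_def)
        qed
      qed
      have "(exchange_step T)\<^sup>*\<^sup>* ?P (swap_labels T L k c r s)"
        by (rule Suc.IH[OF k(3,4)]) (rule agree')
      then show ?thesis using k(5) by (meson rtranclp.rtrancl_into_rtrancl)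
    qed
  qed
  \<comment> \<open>Beyond the largest key the agreement hypothesis is vacuous.\<close>
  define n where "n = Suc (Max ((\<lambda>(k, y). key k y) ` T))"
  have "key k y < n" if "(k, y) \<in> T" for k y
    unfolding n_def less_Suc_eq_le using that assms(1) by (intro Max_ge) (auto intro: rev_image_eqI)
  then show ?thesis using step[OF assms(4,5), of n] by (meson not_le)
qed

section \<open>Descent along the chain of pinned left swaps\<close>

theorem theorem3p4:
  fixes m :: nat and \<alpha> \<alpha>' :: "nat list" and T :: diagram and L :: labeling
  assumes "length \<alpha> = m"
    and "T \<in> PKD \<alpha>"
    and "\<alpha>' \<preceq>\<^sup>0 \<alpha>"
    and "semi_proper T \<alpha>' L"
    and "pinned T L"
  shows "(exchange_step T)\<^sup>*\<^sup>* (proper_labeling \<alpha> T) L"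
proof -
  have "T \<in> KD \<alpha>" and P: "pinned T (proper_labeling \<alpha> T)"
    using assms(2) by (auto simp: PKD_def)
  then have T: "finite T" and cols: "T \<subseteq> {1..} \<times> UNIV"
    using KD_finite_columns by auto
  have "pinned_left_swap\<^sup>*\<^sup>* \<alpha> \<alpha>'" using assms(3) by (simp add: pinned_le_def)
  then show ?thesis using assms(4,5)
  proof (induction arbitrary: L)
    case base
    then show ?case using proper_labeling_reaches_same_shape[OF T cols P] by blast
  next
    case (step \<beta> \<gamma>)
    \<comment> \<open>The last swap of the chain is undone first; the diagram stays fixed while
      shape and labeling change.\<close>
    obtain L' where "semi_proper T \<beta> L'" "pinned T L'" "exchange_step T L' L"
      using pinned_left_swap_pullback[OF cols step.hyps(2) step.prems] by blast
    then show ?case using step.IH by (meson rtranclp.rtrancl_into_rtrancl)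
  qed
qed

end
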